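(* Let $\Delta=p_1\cdots p_n$ be a product of distinct primes $p_i\equiv1\pmod4$. If $a,b$ are positive integers with $ab=\Delta$ and $ar^2-bs^2=4$ has an integral solution, then: (1) $\big(\frac aq\big)=1$ for all primes $q\mid b$; (2) $\big(\frac bp\big)=1$ for all primes $p\mid a$; (3) $\big(\frac ba\big)_4=+1$.
   Context: $\big(\frac{\cdot}{p}\big)$ is the Legendre symbol. For an odd prime $p$ and an integer $b$ with $\big(\frac bp\big)=1$, the quartic symbol $\big(\frac bp\big)_4$ is $+1$ if $b$ is a fourth power modulo $p$ and $-1$ otherwise; for a product $a$ of distinct odd primes each satisfying this condition, $\big(\frac ba\big)_4=\prod_{p\mid a}\big(\frac bp\big)_4$ (and $\big(\frac b1\big)_4=1$). *)

theory Defs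
  imports "HOL-Number_Theory.Number_Theory"
begin

(* The quartic symbol (b/p)_4 is only meaningful for an odd prime p with (b/p) = 1.
   Where (b/p) is not 1 it takes the junk value 0, so it is never +1 or -1 there. *)
definition quartic_symbol_prime :: "int \<Rightarrow> int \<Rightarrow> int"
  where "quartic_symbol_prime b p =
    (if Legendre b p \<noteq> 1 then 0
     else if \<exists>x. [x ^ 4 = b] (mod p) then 1
     else -1)"

(* Only meaningful for a product a of distinct odd primes p (possibly a = 1) with (b/p) = 1. *)
definition quartic_symbol :: "int \<Rightarrow> int \<Rightarrow> int"
  where "quartic_symbol b a = (\<Prod>p\<in>prime_factors a. quartic_symbol_prime b p)"

lemma quartic_symbol_1: "quartic_symbol b 1 = 1"
  by (simp add: quartic_symbol_def)

end

theory Submission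
  imports Defs "HOL-Computational_Algebra.Squarefree"
begin

text \<open>Reducing the equation modulo the primes dividing \<open>b\<close> and \<open>a\<close> gives (1) and (2).
For (3), let \<open>p\<close> be a prime dividing \<open>a\<close> and \<open>i\<close> a square root of \<open>-1\<close> modulo \<open>p\<close>. Then
\<open>b s\<^sup>2\<close> is congruent to \<open>-4\<close>, which is congruent to \<open>(1 + i)\<^sup>4\<close>, so the quartic symbol of \<open>b\<close>
at \<open>p\<close> is the Legendre symbol of \<open>s\<close> at \<open>p\<close>, and it remains to show that the Jacobi symbol
\<open>(s/a)\<close> is 1. Every odd prime \<open>l\<close> dividing \<open>s\<close> satisfies \<open>(a/l) = 1\<close> because \<open>a r\<^sup>2\<close> is
congruent to 4 modulo \<open>l\<close>, and so \<open>(l/a) = 1\<close> by quadratic reciprocity. The powers of 2 in \<open>s\<close>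
contribute nothing: if \<open>s\<close> is even, so is \<open>r\<close>, and the equation divided by 4, read modulo 4 and
modulo 8, shows that either 2 divides \<open>s\<close> to an even power, or \<open>a\<close> is 1 modulo 8,
whence \<open>(2/a) = 1\<close>.\<close>

section \<open>The Legendre symbol\<close>

lemma Legendre_values: "Legendre a p \<in> {-1, 0, 1}"
  by (auto simp: Legendre_def)

lemma Legendre_eq_0_iff: "Legendre a p = 0 \<longleftrightarrow> p dvd a"
  by (auto simp: Legendre_def cong_0_iff)

lemma Legendre_eq_1_iff: "Legendre a p = 1 \<longleftrightarrow> \<not> p dvd a \<and> QuadRes p a"
  by (auto simp: Legendre_def cong_0_iff)

lemma Legendre_cong:
  assumes "[a = b] (mod p)"
  shows "Legendre a p = Legendre b p"
proof -
  have "[x = a] (mod p) \<longleftrightarrow> [x = b] (mod p)" for x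
    using assms by (meson cong_sym cong_trans)
  then show ?thesis
    using cong_dvd_iff[OF assms] by (simp add: Legendre_def QuadRes_def cong_0_iff)
qed

lemma Legendre_square:
  assumes "prime p" "\<not> p dvd x"
  shows "Legendre (x\<^sup>2) p = 1"
  using assms prime_dvd_power[of p x 2]
  by (auto simp: Legendre_eq_1_iff QuadRes_def intro: cong_refl)

lemma Legendre_1: "prime p \<Longrightarrow> Legendre 1 p = 1"
  using Legendre_square[of p 1] by (auto dest: not_prime_unit)

lemma sign_cong_imp_eq:
  fixes x y m :: int
  assumes "[x = y] (mod m)" "2 < m" "x \<in> {-1, 0, 1}" "y \<in> {-1, 0, 1}"
  shows "x = y"
proof (rule ccontr)
  assume "x \<noteq> y"
  moreover have "m dvd x - y"
    using assms(1) by (simp add: cong_iff_dvd_diff)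
  ultimately have "m \<le> \<bar>x - y\<bar>"
    by (intro zdvd_imp_le) auto
  with assms show False by auto
qed

lemma odd_prime_gt_2_int:
  fixes p :: int
  assumes "prime p" "odd p"
  shows "2 < p"
  using assms prime_ge_2_int[of p] by (cases "p = 2") auto

lemma euler_criterion_int:
  fixes p :: int
  assumes "prime p" "odd p"
  shows "[Legendre a p = a ^ nat ((p - 1) div 2)] (mod p)"
proof -
  have "2 < p"
    using assms by (rule odd_prime_gt_2_int)
  then have "prime (nat p)" "2 < nat p"
    using assms by auto
  from euler_criterion[OF this, of a] show ?thesis
    using \<open>2 < p\<close> by (simp add: nat_div_distrib nat_diff_distrib)
qed

lemma Legendre_mult:
  assumes "prime p" "odd p"
  shows "Legendre (a * b) p = Legendre a p * Legendre b p"
proof (rule sign_cong_imp_eq)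
  let ?k = "nat ((p - 1) div 2)"
  have "[Legendre (a * b) p = a ^ ?k * b ^ ?k] (mod p)"
    using euler_criterion_int[OF assms, of "a * b"] by (simp add: power_mult_distrib)
  moreover have "[Legendre a p * Legendre b p = a ^ ?k * b ^ ?k] (mod p)"
    by (intro cong_mult euler_criterion_int assms)
  ultimately show "[Legendre (a * b) p = Legendre a p * Legendre b p] (mod p)"
    by (meson cong_sym cong_trans)
  show "Legendre a p * Legendre b p \<in> {-1, 0, 1}"
    using Legendre_values[of a p] Legendre_values[of b p] by auto
qed (use assms odd_prime_gt_2_int Legendre_values in auto)

lemma Legendre_prod_mset:
  assumes "prime p" "odd p"
  shows "Legendre (\<Prod>\<^sub># M) p = (\<Prod>x\<in>#M. Legendre x p)"
  by (induction M) (simp_all add: Legendre_1 Legendre_mult assms)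

lemma Legendre_eq_1_if_mult_square_cong_square:
  assumes "prime p" "odd p" "\<not> p dvd y" "[a * x\<^sup>2 = y\<^sup>2] (mod p)"
  shows "Legendre a p = 1"
proof -
  have "Legendre a p * (Legendre x p)\<^sup>2 = Legendre (a * x\<^sup>2) p"
    using assms(1,2) by (simp add: Legendre_mult power2_eq_square)
  also have "\<dots> = 1"
    using Legendre_cong[OF assms(4)] Legendre_square[OF assms(1,3)] by simp
  finally show ?thesis
    using Legendre_values[of a p] Legendre_values[of x p] by auto
qed

section \<open>Primes congruent to 1 modulo 4\<close>

lemma cong_1_mod_4_imp_odd:
  fixes n :: int
  assumes "[n = 1] (mod 4)"
  shows "odd n"
  using assms unfolding cong_def by presburger

lemma one_plus_sqrt_minus_1_square:
  fixes i m :: int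
  assumes "[i\<^sup>2 = -1] (mod m)"
  shows "[(1 + i)\<^sup>2 = 2 * i] (mod m)"
  using cong_add[OF assms cong_refl[of "1 + 2 * i"]]
  by (simp add: power2_eq_square algebra_simps)

lemma prime_square_cong_square_imp:
  fixes p :: int
  assumes "prime p" "[x\<^sup>2 = y\<^sup>2] (mod p)"
  shows "[x = y] (mod p) \<or> [x = - y] (mod p)"
proof -
  have "p dvd (x - y) * (x + y)"
    using assms(2) by (simp add: cong_iff_dvd_diff power2_eq_square algebra_simps)
  then show ?thesis
    using assms(1) by (simp add: prime_dvd_mult_iff cong_iff_dvd_diff)
qed

context
  fixes p :: int
  assumes prime: "prime p" and cong_1: "[p = 1] (mod 4)"
begin

private lemma odd_p: "odd p"
  using cong_1 by (rule cong_1_mod_4_imp_odd)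

private lemma not_dvd_2: "\<not> p dvd 2"
  using odd_prime_gt_2_int[OF prime odd_p] by (auto dest: zdvd_imp_le)

private lemma eq_4_mult_plus_1: obtains k where "p = 4 * int k + 1"
proof -
  obtain k where "p - 1 = 4 * k"
    using cong_1 by (auto simp: cong_iff_dvd_diff)
  then have "p = 4 * int (nat k) + 1"
    using prime_gt_0_int[OF prime] by simp
  then show thesis by (rule that)
qed

lemma euler_criterion_1_mod_4: "[Legendre a p = (a\<^sup>2) ^ nat ((p - 1) div 4)] (mod p)"
proof -
  obtain k where "p = 4 * int k + 1"
    using eq_4_mult_plus_1 .
  then show ?thesis
    using euler_criterion_int[OF prime odd_p, of a] by (simp add: nat_mult_distrib power_mult)
qed

lemma Legendre_minus_1: "Legendre (-1) p = 1"
  using euler_criterion_1_mod_4[of "-1"] odd_prime_gt_2_int[OF prime odd_p] Legendre_values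
  by (intro sign_cong_imp_eq) auto

lemma Legendre_uminus: "Legendre (- a) p = Legendre a p"
  using Legendre_mult[OF prime odd_p, of "-1" a] by (simp add: Legendre_minus_1)

lemma sqrt_minus_1_mod: obtains i where "[i\<^sup>2 = -1] (mod p)"
  using Legendre_minus_1 by (auto simp: Legendre_eq_1_iff QuadRes_def)

text \<open>Since \<open>2 i\<close> is the square of \<open>1 + i\<close>, the symbols of 2 and \<open>i\<close> agree.\<close>

lemma Legendre_2: "Legendre 2 p = (if [p = 1] (mod 8) then 1 else -1)"
proof -
  obtain i where i: "[i\<^sup>2 = -1] (mod p)"
    using sqrt_minus_1_mod .
  have "\<not> p dvd i\<^sup>2"
    using cong_dvd_iff[OF i] prime not_prime_unit[of p] by auto
  then have "\<not> p dvd 2 * i"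
    using prime not_dvd_2 by (auto simp: prime_dvd_mult_iff power2_eq_square)
  then have "Legendre (2 * i) p = 1"
    using one_plus_sqrt_minus_1_square[OF i] unfolding Legendre_eq_1_iff QuadRes_def by blast
  then have "Legendre 2 p * Legendre i p = 1"
    by (simp add: Legendre_mult prime odd_p)
  then have "Legendre 2 p = Legendre i p"
    using Legendre_values[of 2 p] Legendre_values[of i p] by auto
  also have "\<dots> = (-1) ^ nat ((p - 1) div 4)"
    using cong_trans[OF euler_criterion_1_mod_4 cong_pow[OF i]]
      odd_prime_gt_2_int[OF prime odd_p] Legendre_values
    by (intro sign_cong_imp_eq) (auto simp: minus_one_power_iff)
  also have "\<dots> = (if [p = 1] (mod 8) then 1 else -1)"
  proof -
    obtain k where k: "p = 4 * int k + 1"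
      using eq_4_mult_plus_1 .
    then have "[p = 1] (mod 8) \<longleftrightarrow> even k"
      by (simp add: cong_iff_dvd_diff) presburger
    with k show ?thesis
      by (simp add: minus_one_power_iff)
  qed
  finally show ?thesis .
qed

lemma Legendre_reciprocity_1_mod_4:
  assumes "prime q" "odd q"
  shows "Legendre q p = Legendre p q"
proof (cases "p = q")
  case False
  have gt_2: "2 < p" "2 < q"
    using odd_prime_gt_2_int prime odd_p assms by auto
  obtain k where "p = 4 * int k + 1"
    using eq_4_mult_plus_1 .
  then have "even (nat ((p - 1) div 2 * ((q - 1) div 2)))"
    using gt_2 by (simp add: even_nat_iff)
  then have "Legendre p q * Legendre q p = 1"
    using Quadratic_Reciprocity_int[of p q] gt_2 prime assms(1) False by simp
  then show ?thesis
    using Legendre_values[of p q] Legendre_values[of q p] by auto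
qed simp

section \<open>Quartic residues\<close>

lemma minus_4_cong_fourth_power:
  obtains c where "[-4 = c ^ 4] (mod p)" "\<not> p dvd c"
proof -
  obtain i where i: "[i\<^sup>2 = -1] (mod p)"
    using sqrt_minus_1_mod .
  have "[((1 + i)\<^sup>2)\<^sup>2 = (2 * i)\<^sup>2] (mod p)"
    by (intro cong_pow one_plus_sqrt_minus_1_square i)
  also have "[(2 * i)\<^sup>2 = -4] (mod p)"
    using cong_scalar_left[OF i, of 4] by (simp add: power_mult_distrib)
  finally have fourth: "[(1 + i) ^ 4 = -4] (mod p)"
    by (simp flip: power_mult)
  have "\<not> p dvd -4"
    using prime not_dvd_2 prime_dvd_mult_iff[of p 2 2] by simp
  then have "\<not> p dvd 1 + i"
    using cong_dvd_iff[OF fourth] prime by (simp add: prime_dvd_power_iff)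
  with cong_sym[OF fourth] show thesis by (rule that)
qed

context
  fixes b s c :: int
  assumes cong_fourth_power: "[b * s\<^sup>2 = c ^ 4] (mod p)" and not_dvd: "\<not> p dvd c"
begin

private lemma not_dvd_s: "\<not> p dvd s"
proof
  assume "p dvd s"
  then have "p dvd b * s\<^sup>2"
    by (simp add: power2_eq_square)
  then have "p dvd c ^ 4"
    using cong_dvd_iff[OF cong_fourth_power] by simp
  with not_dvd show False
    using prime_dvd_power[OF prime] by blast
qed

lemma Legendre_eq_1_if_mult_square_cong_fourth_power: "Legendre b p = 1"
proof (rule Legendre_eq_1_if_mult_square_cong_square[OF prime odd_p])
  show "\<not> p dvd c\<^sup>2"
    using not_dvd prime_dvd_power[OF prime] by blast
  show "[b * s\<^sup>2 = (c\<^sup>2)\<^sup>2] (mod p)"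
    using cong_fourth_power by (simp flip: power_mult)
qed

private lemma Legendre_eq_1_if_fourth_power_residue:
  assumes "[x ^ 4 = b] (mod p)"
  shows "Legendre s p = 1"
proof -
  have "[x ^ 4 * s\<^sup>2 = c ^ 4] (mod p)"
    using cong_trans[OF cong_scalar_right[OF assms] cong_fourth_power] .
  then have "[(s * x\<^sup>2)\<^sup>2 = (c\<^sup>2)\<^sup>2] (mod p)"
    by (simp add: power_mult_distrib mult.commute flip: power_mult)
  then consider (plus) "[s * x\<^sup>2 = c\<^sup>2] (mod p)" | (minus) "[s * x\<^sup>2 = - c\<^sup>2] (mod p)"
    using prime_square_cong_square_imp[OF prime] by blast
  then show ?thesis
  proof cases
    case plus
    then show ?thesis
      by (rule Legendre_eq_1_if_mult_square_cong_square[OF prime odd_p not_dvd])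
  next
    case minus
    then have "[- s * x\<^sup>2 = c\<^sup>2] (mod p)"
      using cong_minus_minus_iff[of "s * x\<^sup>2" "- c\<^sup>2" p] by simp
    then have "Legendre (- s) p = 1"
      by (rule Legendre_eq_1_if_mult_square_cong_square[OF prime odd_p not_dvd])
    then show ?thesis
      by (simp add: Legendre_uminus)
  qed
qed

private lemma fourth_power_residue_if_QuadRes:
  assumes "QuadRes p s"
  obtains x where "[x ^ 4 = b] (mod p)"
proof -
  from assms obtain t where t: "[t\<^sup>2 = s] (mod p)"
    by (auto simp: QuadRes_def)
  with not_dvd_s have "\<not> p dvd t"
    using cong_dvd_iff[OF t] by (auto simp: power2_eq_square)
  then have "coprime t p"
    using prime_imp_coprime[OF prime] coprime_commute by blast
  then obtain u where u: "[t * u = 1] (mod p)"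
    using cong_solve_coprime_int by blast
  have "[c ^ 4 * u ^ 4 = b * s\<^sup>2 * u ^ 4] (mod p)"
    by (intro cong_scalar_right cong_sym[OF cong_fourth_power])
  also have "[b * s\<^sup>2 * u ^ 4 = b * (t\<^sup>2)\<^sup>2 * u ^ 4] (mod p)"
    by (intro cong_scalar_right cong_scalar_left cong_pow cong_sym[OF t])
  also have "b * (t\<^sup>2)\<^sup>2 * u ^ 4 = b * (t * u) ^ 4"
    by (simp add: power_mult_distrib flip: power_mult)
  also have "[b * (t * u) ^ 4 = b * 1 ^ 4] (mod p)"
    by (intro cong_scalar_left cong_pow u)
  finally have "[(c * u) ^ 4 = b] (mod p)"
    by (simp add: power_mult_distrib)
  then show thesis by (rule that)
qed

lemma quartic_symbol_prime_eq_Legendre: "quartic_symbol_prime b p = Legendre s p"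
proof -
  have "(\<exists>x. [x ^ 4 = b] (mod p)) \<longleftrightarrow> Legendre s p = 1"
    using Legendre_eq_1_if_fourth_power_residue fourth_power_residue_if_QuadRes
    unfolding Legendre_eq_1_iff by blast
  moreover have "Legendre s p \<in> {-1, 1}"
    using Legendre_values[of s p] not_dvd_s by (auto simp: Legendre_eq_0_iff)
  ultimately show ?thesis
    by (auto simp: quartic_symbol_prime_def Legendre_eq_1_if_mult_square_cong_fourth_power)
qed

end

end

section \<open>The Jacobi symbol\<close>

(* Meaningful only for odd n > 0: the sign of n is ignored and Jacobi m 0 = 1. *)
definition Jacobi :: "int \<Rightarrow> int \<Rightarrow> int"
  where "Jacobi m n = (\<Prod>p\<in>#prime_factorization n. Legendre m p)"

lemma Jacobi_1_right: "Jacobi m 1 = 1"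
  by (simp add: Jacobi_def)

lemma Jacobi_prime_mult_right:
  assumes "prime p" "n \<noteq> 0"
  shows "Jacobi m (p * n) = Legendre m p * Jacobi m n"
  using assms by (simp add: Jacobi_def prime_factorization_times_prime)

lemma Jacobi_1_left: "Jacobi 1 n = 1"
  unfolding Jacobi_def by (intro prod_mset.neutral) (auto intro: Legendre_1)

lemma Jacobi_mult:
  assumes "odd n"
  shows "Jacobi (x * y) n = Jacobi x n * Jacobi y n"
proof -
  have "Legendre (x * y) p = Legendre x p * Legendre y p" if "p \<in># prime_factorization n" for p
    using that assms by (intro Legendre_mult) (auto dest: dvd_trans)
  then have "Jacobi (x * y) n = (\<Prod>p\<in>#prime_factorization n. Legendre x p * Legendre y p)"
    unfolding Jacobi_def by (intro arg_cong[of _ _ prod_mset] image_mset_cong)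
  then show ?thesis
    by (simp add: Jacobi_def prod_mset.distrib)
qed

lemma Jacobi_power:
  assumes "odd n"
  shows "Jacobi (x ^ k) n = Jacobi x n ^ k"
  by (induction k) (simp_all add: Jacobi_1_left Jacobi_mult assms)

lemma prod_mset_cong_1:
  fixes M :: "int multiset"
  assumes "\<And>x. x \<in># M \<Longrightarrow> [x = 1] (mod m)"
  shows "[\<Prod>\<^sub># M = 1] (mod m)"
  using assms
proof (induction M)
  case (add x M)
  then have "[x * \<Prod>\<^sub># M = 1 * 1] (mod m)"
    by (intro cong_mult) auto
  then show ?case by simp
qed simp

lemma cong_1_if_prime_factors_cong_1:
  fixes n m :: int
  assumes "n > 0" "\<And>p. p \<in> prime_factors n \<Longrightarrow> [p = 1] (mod m)"
  shows "[n = 1] (mod m)"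
  using prod_mset_cong_1[of "prime_factorization n" m] assms
  by (simp add: prod_mset_prime_factorization_int)

lemma cong_1_mod_4_imp_mod_8:
  fixes n :: int
  assumes "[n = 1] (mod 4)"
  shows "n mod 8 \<in> {1, 5}"
proof -
  have "n mod 4 = 1"
    using assms by (simp add: cong_def)
  then have "n mod 8 = 1 \<or> n mod 8 = 5"
    by presburger
  then show ?thesis by simp
qed

lemma Jacobi_2:
  assumes "n > 0" "\<And>p. p \<in> prime_factors n \<Longrightarrow> [p = 1] (mod 4)"
  shows "Jacobi 2 n = (if [n = 1] (mod 8) then 1 else -1)"
  using assms
proof (induction n rule: prime_divisors_induct)
  case (unit n)
  then show ?case by (simp add: Jacobi_1_right)
next
  case (factor p n)
  have "n > 0"
    using factor.prems(1) prime_gt_0_int[OF factor.hyps] by (simp add: zero_less_mult_iff)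
  then have "prime_factors (p * n) = insert p (prime_factors n)"
    using factor.hyps by (simp add: prime_factorization_times_prime)
  then have p_cong: "[p = 1] (mod 4)"
    and n_factors: "\<And>q. q \<in> prime_factors n \<Longrightarrow> [q = 1] (mod 4)"
    using factor.prems(2) by auto
  have "[n = 1] (mod 4)"
    using \<open>n > 0\<close> n_factors by (rule cong_1_if_prime_factors_cong_1)
  with p_cong have "p mod 8 \<in> {1, 5}" "n mod 8 \<in> {1, 5}"
    by (simp_all add: cong_1_mod_4_imp_mod_8 del: insert_iff)
  moreover have "(p * n) mod 8 = ((p mod 8) * (n mod 8)) mod 8"
    by (simp add: mod_mult_eq)
  ultimately have "[p * n = 1] (mod 8) \<longleftrightarrow> ([p = 1] (mod 8) \<longleftrightarrow> [n = 1] (mod 8))"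
    by (auto simp: cong_def)
  moreover have "Jacobi 2 (p * n) = Legendre 2 p * Jacobi 2 n"
    using factor.hyps \<open>n > 0\<close> by (simp add: Jacobi_prime_mult_right)
  moreover have "Jacobi 2 n = (if [n = 1] (mod 8) then 1 else -1)"
    using \<open>n > 0\<close> n_factors by (rule factor.IH)
  ultimately show ?case
    by (simp add: Legendre_2 factor.hyps p_cong)
qed simp

context
  fixes n :: int
  assumes pos: "n > 0" and cong_1: "\<And>p. p \<in> prime_factors n \<Longrightarrow> [p = 1] (mod 4)"
begin

private lemma odd_n: "odd n"
  using cong_1_mod_4_imp_odd cong_1_if_prime_factors_cong_1 pos cong_1 by blast

lemma Jacobi_minus_1: "Jacobi (-1) n = 1"
  unfolding Jacobi_def by (intro prod_mset.neutral) (auto intro: Legendre_minus_1 cong_1)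

lemma Jacobi_odd_prime_eq_Legendre:
  assumes "prime l" "odd l"
  shows "Jacobi l n = Legendre n l"
proof -
  have "Jacobi l n = (\<Prod>p\<in>#prime_factorization n. Legendre p l)"
    unfolding Jacobi_def using Legendre_reciprocity_1_mod_4[OF _ cong_1 assms]
    by (intro arg_cong[of _ _ prod_mset] image_mset_cong) auto
  also have "\<dots> = Legendre n l"
    using Legendre_prod_mset[OF assms, of "prime_factorization n"] pos
    by (simp add: prod_mset_prime_factorization_int)
  finally show ?thesis .
qed

lemma Jacobi_eq_1_if_Legendre_eq_1:
  assumes "odd m" "\<And>l. prime l \<Longrightarrow> l dvd m \<Longrightarrow> Legendre n l = 1"
  shows "Jacobi m n = 1"
  using assms
proof (induction m rule: prime_divisors_induct)
  case (unit m)
  then have "m = 1 \<or> m = -1" by auto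
  then show ?case by (auto simp: Jacobi_1_left Jacobi_minus_1)
next
  case (factor l m)
  then show ?case
    by (simp add: Jacobi_mult odd_n Jacobi_odd_prime_eq_Legendre)
qed simp

end

section \<open>Products of distinct primes\<close>

lemma squarefree_prod_distinct_primes:
  fixes f :: "'a \<Rightarrow> 'b :: factorial_semiring_gcd"
  assumes "\<And>x. x \<in> A \<Longrightarrow> prime (f x)" "inj_on f A"
  shows "squarefree (\<Prod>x\<in>A. f x)"
  using assms
  by (intro squarefree_prod_coprime primes_coprime squarefree_prime) (auto dest: inj_onD)

lemma prime_factors_prod_primes:
  assumes "finite A" "\<And>x. x \<in> A \<Longrightarrow> prime (f x)"
  shows "prime_factors (\<Prod>x\<in>A. f x) = f ` A"
proof -
  have "prime_factorization (\<Prod>x\<in>A. f x) = image_mset f (mset_set A)"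
    unfolding prod_unfold_prod_mset
    using assms by (intro prime_factorization_prod_mset_primes) auto
  then show ?thesis
    using assms(1) by simp
qed

lemma squarefree_imp_prime_factorization_eq:
  fixes n :: "'a :: factorial_semiring"
  assumes "squarefree n"
  shows "prime_factorization n = mset_set (prime_factors n)"
proof (rule multiset_eqI)
  fix p
  have "n \<noteq> 0"
    using assms by auto
  then have "multiplicity q n = 1" if "q \<in> prime_factors n" for q
    using assms that squarefree_factorial_semiring' by blast
  then show "count (prime_factorization n) p = count (mset_set (prime_factors n)) p"
    by (cases "p \<in> prime_factors n")
      (auto simp: count_prime_factorization_prime in_prime_factors_imp_prime not_in_iff)
qed

lemma quartic_symbol_eq_Jacobi:
  assumes "squarefree a" "\<And>p. p \<in> prime_factors a \<Longrightarrow> [p = 1] (mod 4)"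
    and "[b * s\<^sup>2 = -4] (mod a)"
  shows "quartic_symbol b a = Jacobi s a"
proof -
  have "quartic_symbol_prime b p = Legendre s p" if "p \<in> prime_factors a" for p
  proof -
    have "prime p" "p dvd a" "[p = 1] (mod 4)"
      using that assms(2) by auto
    then obtain c where c: "[-4 = c ^ 4] (mod p)" "\<not> p dvd c"
      using minus_4_cong_fourth_power by blast
    have "[b * s\<^sup>2 = c ^ 4] (mod p)"
      using cong_dvd_modulus[OF assms(3) \<open>p dvd a\<close>] c(1) by (rule cong_trans)
    then show ?thesis
      using c(2) by (rule quartic_symbol_prime_eq_Legendre[OF \<open>prime p\<close> \<open>[p = 1] (mod 4)\<close>])
  qed
  then have "quartic_symbol b a = (\<Prod>p\<in>prime_factors a. Legendre s p)"
    by (simp add: quartic_symbol_def)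
  also have "\<dots> = Jacobi s a"
    using squarefree_imp_prime_factorization_eq[OF assms(1)]
    by (simp add: Jacobi_def prod_unfold_prod_mset)
  finally show ?thesis .
qed

section \<open>The equation \<open>a r\<^sup>2 - b s\<^sup>2 = 4\<close>\<close>

lemma odd_square_cong_1_mod_8:
  fixes x :: int
  assumes "odd x"
  shows "[x\<^sup>2 = 1] (mod 8)"
proof -
  have "[(nat \<bar>x\<bar>)\<^sup>2 = 1] (mod 8)"
    using assms square_mod_8_eq_1_iff[of "nat \<bar>x\<bar>"] by (simp add: even_nat_iff)
  then have "[int ((nat \<bar>x\<bar>)\<^sup>2) = int 1] (mod int 8)"
    by (simp only: cong_int_iff)
  then show ?thesis by simp
qed

lemma even_if_diff_squares_eq_1:
  fixes a b x y :: int
  assumes "a * x\<^sup>2 - b * y\<^sup>2 = 1" "[a = 1] (mod 4)" "[b = 1] (mod 4)"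
  shows "even y"
proof (rule ccontr)
  assume "odd y"
  then have "[y\<^sup>2 = 1] (mod 4)"
    using cong_dvd_modulus[OF odd_square_cong_1_mod_8, of y 4] by simp
  then have "[1 + b * y\<^sup>2 = 1 + 1 * 1] (mod 4)"
    by (intro cong_add cong_mult cong_refl assms(3))
  moreover have "a * x\<^sup>2 = 1 + b * y\<^sup>2"
    using assms(1) by simp
  ultimately have cong_2: "[a * x\<^sup>2 = 2] (mod 4)"
    by simp
  have "even (a * x\<^sup>2)"
    using cong_dvd_iff[OF cong_dvd_modulus[OF cong_2, of 2]] by simp
  moreover have "odd a"
    using assms(2) by (rule cong_1_mod_4_imp_odd)
  ultimately have "4 dvd a * x\<^sup>2"
    by (auto simp: power2_eq_square)
  then show False
    using cong_dvd_iff[OF cong_2] by simp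
qed

lemma cong_1_mod_8_if_diff_squares_eq_1:
  fixes a b x y :: int
  assumes "a * x\<^sup>2 - b * y\<^sup>2 = 1" "4 dvd y"
  shows "[a = 1] (mod 8)"
proof -
  have "8 dvd b * y\<^sup>2"
    using assms(2) by (auto simp: power2_eq_square)
  moreover have "a * x\<^sup>2 - 1 = b * y\<^sup>2"
    using assms(1) by simp
  ultimately have cong_1: "[a * x\<^sup>2 = 1] (mod 8)"
    by (simp add: cong_iff_dvd_diff)
  then have "odd (a * x\<^sup>2)"
    using cong_dvd_iff[OF cong_dvd_modulus[OF cong_1, of 2]] by simp
  then have "[a * 1 = a * x\<^sup>2] (mod 8)"
    by (intro cong_scalar_left cong_sym[OF odd_square_cong_1_mod_8]) simp
  then show ?thesis
    using cong_trans[OF _ cong_1] by simp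
qed

context
  fixes a b r s :: int
  assumes diff_eq_4: "a * r\<^sup>2 - b * s\<^sup>2 = 4"
begin

lemma Legendre_eq_1_if_odd_prime_dvd:
  assumes "prime q" "odd q" "q dvd b * s\<^sup>2"
  shows "Legendre a q = 1"
proof (rule Legendre_eq_1_if_mult_square_cong_square[OF assms(1,2)])
  show "\<not> q dvd 2"
    using odd_prime_gt_2_int[OF assms(1,2)] by (auto dest: zdvd_imp_le)
  have "a * r\<^sup>2 - 2\<^sup>2 = b * s\<^sup>2"
    using diff_eq_4 by simp
  then show "[a * r\<^sup>2 = 2\<^sup>2] (mod q)"
    using assms(3) by (simp add: cong_iff_dvd_diff)
qed

lemma mult_square_cong_minus_4: "[b * s\<^sup>2 = -4] (mod a)"
proof -
  have "b * s\<^sup>2 - (-4) = a * r\<^sup>2"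
    using diff_eq_4 by simp
  then show ?thesis
    by (simp add: cong_iff_dvd_diff)
qed

lemma Legendre_eq_1_if_prime_1_mod_4_dvd:
  assumes "prime p" "[p = 1] (mod 4)" "p dvd a"
  shows "Legendre b p = 1"
proof -
  obtain c where c: "[-4 = c ^ 4] (mod p)" "\<not> p dvd c"
    using minus_4_cong_fourth_power[OF assms(1,2)] .
  have "[b * s\<^sup>2 = c ^ 4] (mod p)"
    using cong_dvd_modulus[OF mult_square_cong_minus_4 assms(3)] c(1) by (rule cong_trans)
  then show ?thesis
    using c(2) by (rule Legendre_eq_1_if_mult_square_cong_fourth_power[OF assms(1,2)])
qed

lemma even_multiplicity_2_or_cong_1_mod_8:
  assumes "[a = 1] (mod 4)" "[b = 1] (mod 4)"
  shows "even (multiplicity 2 s) \<or> [a = 1] (mod 8)"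
proof (rule disjCI)
  assume "\<not> [a = 1] (mod 8)"
  show "even (multiplicity 2 s)"
  proof (cases "even s")
    case True
    then obtain y where y: "s = 2 * y" ..
    have "a * r\<^sup>2 = 4 + b * s\<^sup>2"
      using diff_eq_4 by simp
    then have "even (a * r\<^sup>2)"
      using True by simp
    then obtain x where x: "r = 2 * x"
      using cong_1_mod_4_imp_odd[OF assms(1)] by auto
    have "a * x\<^sup>2 - b * y\<^sup>2 = 1"
      using diff_eq_4 by (simp add: x y power_mult_distrib)
    then have "even y" "\<not> 2\<^sup>2 dvd y"
      using even_if_diff_squares_eq_1[OF _ assms] cong_1_mod_8_if_diff_squares_eq_1
        \<open>\<not> [a = 1] (mod 8)\<close> by auto
    then have "multiplicity 2 y = 1"
      by (intro multiplicity_eqI) (simp_all add: numeral_2_eq_2)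
    moreover have "y \<noteq> 0"
      using \<open>\<not> 2\<^sup>2 dvd y\<close> by auto
    ultimately show ?thesis
      by (simp add: y multiplicity_times_same)
  qed (simp add: not_dvd_imp_multiplicity_0)
qed

lemma a_eq_1_if_s_eq_0:
  assumes "odd a" "a > 0" "s = 0"
  shows "a = 1"
proof -
  have "a dvd 2\<^sup>2"
    using diff_eq_4 assms(3) by (intro dvdI[of _ _ "r\<^sup>2"]) simp
  moreover have "coprime a (2\<^sup>2)"
    using assms(1) by (simp only: coprime_power_right_iff coprime_right_2_iff_odd simp_thms)
  ultimately show ?thesis
    using assms(2) by (simp add: coprime_absorb_left)
qed

lemma Jacobi_eq_1_if_diff_eq_4:
  assumes "a > 0" "\<And>p. p \<in> prime_factors a \<Longrightarrow> [p = 1] (mod 4)" "[b = 1] (mod 4)"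
  shows "Jacobi s a = 1"
proof -
  have a_cong: "[a = 1] (mod 4)"
    using assms(1,2) by (rule cong_1_if_prime_factors_cong_1)
  then have "odd a"
    by (rule cong_1_mod_4_imp_odd)
  show ?thesis
  proof (cases "s = 0")
    case True
    then show ?thesis
      using a_eq_1_if_s_eq_0 \<open>odd a\<close> assms(1) by (simp add: Jacobi_1_right)
  next
    case False
    define k where "k = multiplicity 2 s"
    obtain m where m: "s = 2 ^ k * m" "odd m"
      using multiplicity_decompose'[of s 2] False unfolding k_def by auto
    have "Jacobi m a = 1"
    proof (rule Jacobi_eq_1_if_Legendre_eq_1[OF assms(1,2) \<open>odd m\<close>])
      fix l assume "prime l" "l dvd m"
      moreover from this have "odd l"
        using \<open>odd m\<close> dvd_trans by blast
      ultimately show "Legendre a l = 1"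
        using m(1) by (intro Legendre_eq_1_if_odd_prime_dvd) (simp_all add: power2_eq_square)
    qed
    moreover have "Jacobi 2 a ^ k = 1"
      using even_multiplicity_2_or_cong_1_mod_8[OF a_cong assms(3)] Jacobi_2[OF assms(1,2)]
      by (auto simp: k_def)
    ultimately show ?thesis
      by (simp add: m(1) Jacobi_mult Jacobi_power \<open>odd a\<close>)
  qed
qed

end

theorem theorem6p7:
  fixes n :: nat and p :: "nat \<Rightarrow> int" and \<Delta> a b :: int
  assumes "\<And>i. i \<in> {1..n} \<Longrightarrow> prime (p i)"
    and "\<And>i. i \<in> {1..n} \<Longrightarrow> [p i = 1] (mod 4)"
    and "inj_on p {1..n}"
    and "\<Delta> = (\<Prod>i=1..n. p i)"
    and "a > 0" and "b > 0" and "a * b = \<Delta>"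
    and "\<exists>r s :: int. a * r\<^sup>2 - b * s\<^sup>2 = 4"
  shows "(\<forall>q. prime q \<and> q dvd b \<longrightarrow> Legendre a q = 1) \<and>
         (\<forall>q. prime q \<and> q dvd a \<longrightarrow> Legendre b q = 1) \<and>
         quartic_symbol b a = 1"
proof -
  from assms(8) obtain r s where equation: "a * r\<^sup>2 - b * s\<^sup>2 = 4" by blast
  have "prime_factors (a * b) = p ` {1..n}"
    unfolding assms(4,7) using finite_atLeastAtMost assms(1) by (rule prime_factors_prod_primes)
  then have "[q = 1] (mod 4)" if "q \<in> prime_factors (a * b)" for q
    using that assms(2) by auto
  then have a_factors: "\<And>q. q \<in> prime_factors a \<Longrightarrow> [q = 1] (mod 4)"
    and b_factors: "\<And>q. q \<in> prime_factors b \<Longrightarrow> [q = 1] (mod 4)"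
    using assms(5,6) by (simp_all add: prime_factorization_mult)
  have squarefree: "squarefree (a * b)"
    unfolding assms(4,7) using assms(1,3) by (rule squarefree_prod_distinct_primes)
  have "Legendre a q = 1" if "prime q" "q dvd b" for q
    using that assms(6) cong_1_mod_4_imp_odd[OF b_factors]
    by (intro Legendre_eq_1_if_odd_prime_dvd[OF equation]) (simp_all add: prime_factorsI)
  moreover have "Legendre b q = 1" if "prime q" "q dvd a" for q
    using that assms(5)
    by (intro Legendre_eq_1_if_prime_1_mod_4_dvd[OF equation] a_factors prime_factorsI) auto
  moreover have "quartic_symbol b a = Jacobi s a"
    using squarefree_multD(1)[OF squarefree] a_factors mult_square_cong_minus_4[OF equation]
    by (rule quartic_symbol_eq_Jacobi)
  moreover have "Jacobi s a = 1"
    using assms(5) a_factors cong_1_if_prime_factors_cong_1[OF assms(6) b_factors]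
    by (rule Jacobi_eq_1_if_diff_eq_4[OF equation])
  ultimately show ?thesis by simp
qed

end
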